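(* For any $\alpha\le1$ smaller than some absolute constant, any $\left(\varepsilon,\frac{3}{64n}\right)$-differentially private mechanism which, given $n$ i.i.d. samples from an arbitrary unknown product distribution over $\{0,1\}^d$, estimates the product distribution to accuracy $\le\alpha$ in total variation distance with probability $\ge2/3$ requires $n=\Omega\left(\frac{d}{\alpha\varepsilon\log d}\right)$ samples.
   Context: Two datasets are neighboring if they differ in one entry. A randomized mechanism $M$ is $(\varepsilon,\delta)$-differentially private if for all neighboring datasets $X,X'$ and measurable $Y$, $\Pr[M(X)\in Y]\le e^\varepsilon\Pr[M(X')\in Y]+\delta$. A product distribution over $\{0,1\}^d$ has independent Bernoulli coordinates. *)

theory Defs
  imports "HOL-Probability.Probability"
begin

text \<open>
  Points of \<open>{0,1}^d\<close> are extensional functions on \<open>{..<d}\<close>, and datasets of \<open>n\<close> entries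
  are extensional functions on \<open>{..<n}\<close>.
\<close>

definition bitcube :: "nat \<Rightarrow> (nat \<Rightarrow> bool) measure" where
  "bitcube d = PiM {..<d} (\<lambda>_. count_space UNIV)"

definition product_distribution :: "nat \<Rightarrow> (nat \<Rightarrow> real) \<Rightarrow> (nat \<Rightarrow> bool) measure" where
  "product_distribution d p = PiM {..<d} (\<lambda>j. measure_pmf (bernoulli_pmf (p j)))"

definition datasets :: "nat \<Rightarrow> 'a measure \<Rightarrow> (nat \<Rightarrow> 'a) measure" where
  "datasets n D = PiM {..<n} (\<lambda>_. D)"

definition iid_samples :: "nat \<Rightarrow> 'a measure \<Rightarrow> (nat \<Rightarrow> 'a) measure" where
  "iid_samples n P = PiM {..<n} (\<lambda>_. P)"

definition neighboring :: "nat \<Rightarrow> (nat \<Rightarrow> 'a) \<Rightarrow> (nat \<Rightarrow> 'a) \<Rightarrow> bool" where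
  "neighboring n X X' \<longleftrightarrow> card {i \<in> {..<n}. X i \<noteq> X' i} = 1"

text \<open>
  A randomized mechanism is a Markov kernel: \<open>M X\<close> is the distribution of the output on the
  dataset \<open>X\<close>.
\<close>

definition mechanism :: "nat \<Rightarrow> 'a measure \<Rightarrow> 'b measure \<Rightarrow> ((nat \<Rightarrow> 'a) \<Rightarrow> 'b measure) \<Rightarrow> bool" where
  "mechanism n D R M \<longleftrightarrow> M \<in> datasets n D \<rightarrow>\<^sub>M prob_algebra R"

definition differentially_private ::
  "nat \<Rightarrow> 'a measure \<Rightarrow> 'b measure \<Rightarrow> real \<Rightarrow> real \<Rightarrow> ((nat \<Rightarrow> 'a) \<Rightarrow> 'b measure) \<Rightarrow> bool" where
  "differentially_private n D R \<epsilon> \<delta> M \<longleftrightarrow>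
     (\<forall>X \<in> space (datasets n D). \<forall>X' \<in> space (datasets n D). neighboring n X X' \<longrightarrow>
        (\<forall>Y \<in> sets R. measure (M X) Y \<le> exp \<epsilon> * measure (M X') Y + \<delta>))"

definition tv_dist :: "'a measure \<Rightarrow> 'a measure \<Rightarrow> real" where
  "tv_dist P Q = (SUP A \<in> sets P. \<bar>measure P A - measure Q A\<bar>)"

text \<open>
  The output of an estimator is itself a distribution on the cube, hence a point of
  \<^term>\<open>prob_algebra (bitcube d)\<close>, whose sigma-algebra is generated by the evaluations
  \<open>Q \<mapsto> Q A\<close>. The output is not required to be a product distribution. The success
  probability is over both the samples and the randomness of the mechanism.
\<close>

definition estimates_product_distributions ::
  "nat \<Rightarrow> nat \<Rightarrow> real \<Rightarrow> real \<Rightarrow> ((nat \<Rightarrow> nat \<Rightarrow> bool) \<Rightarrow> (nat \<Rightarrow> bool) measure measure) \<Rightarrow> bool" where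
  "estimates_product_distributions n d \<alpha> \<beta> M \<longleftrightarrow>
     (\<forall>p. (\<forall>j<d. 0 \<le> p j \<and> p j \<le> 1) \<longrightarrow>
        measure (iid_samples n (product_distribution d p) \<bind> M)
          {Q \<in> space (prob_algebra (bitcube d)). tv_dist Q (product_distribution d p) \<le> \<alpha>} \<ge> \<beta>)"

end

theory Submission
  imports Defs
begin

text \<open>
  A differentially private version of Assouad's method. For \<open>S \<subseteq> {..<d}\<close> let \<open>P\<^sub>S\<close> have bias
  \<open>g = 96 \<alpha> / d\<close> on \<open>S\<close> and \<open>0\<close> elsewhere. Distributions that are both \<open>\<alpha>\<close>-close to the same
  output differ in at most \<open>d / 12\<close> coordinates, so an accurate mechanism recovers each coordinate of
  a uniformly random \<open>S\<close> with average error at most \<open>1 / 12 + 1 / 3 = 5 / 12\<close>. On the other hand,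
  clearing column \<open>j\<close> turns a sample from \<open>P\<^sub>S\<close> into a sample from the distribution of \<open>S - {j}\<close> and
  changes only \<open>n g\<close> entries in expectation. Privacy makes the output law Lipschitz in the
  Hamming distance with constant \<open>2 \<epsilon> + \<delta>\<close>, so the average error is at least
  \<open>(1 - n g (2 \<epsilon> + \<delta>)) / 2\<close>. The argument loses no logarithm; the factor \<open>ln d\<close> in the theorem
  is only used through \<open>ln d \<ge> 1 / 2\<close>.
\<close>

section \<open>Product distributions on the cube\<close>

lemma prob_space_product_distribution: "prob_space (product_distribution d p)"
  unfolding product_distribution_def by (intro prob_space_PiM) (rule prob_space_measure_pmf)

lemma sets_product_distribution [measurable_cong]: "sets (product_distribution d p) = sets (bitcube d)"
  unfolding product_distribution_def bitcube_def by (intro sets_PiM_cong) auto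

lemma space_bitcube: "space (bitcube d) = {..<d} \<rightarrow>\<^sub>E UNIV"
  by (simp add: bitcube_def space_PiM)

lemma space_product_distribution: "space (product_distribution d p) = {..<d} \<rightarrow>\<^sub>E UNIV"
  by (simp add: product_distribution_def space_PiM)

lemma sets_bitcube: "sets (bitcube d) = Pow ({..<d} \<rightarrow>\<^sub>E UNIV)"
  unfolding bitcube_def by (subst count_space_PiM_finite) auto

lemma measure_product_distribution_PiE:
  "measure (product_distribution d p) (Pi\<^sub>E {..<d} A) = (\<Prod>i<d. measure_pmf.prob (bernoulli_pmf (p i)) (A i))"
proof -
  interpret finite_product_prob_space "\<lambda>j. measure_pmf (bernoulli_pmf (p j))" "{..<d}"
    by unfold_locales auto
  show ?thesis
    unfolding product_distribution_def by (rule finite_measure_PiM_emb) auto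
qed

lemma bernoulli_pmf_0: "bernoulli_pmf 0 = return_pmf False"
proof (rule pmf_eqI)
  show "pmf (bernoulli_pmf 0) b = pmf (return_pmf False) b" for b
    by (cases b) auto
qed

text \<open>It suffices to compare boxes. The preimage of a box is empty if its side at
  \<open>j\<close> omits \<open>False\<close>, matching the factor 0 of the point mass at
  \<open>False\<close>; otherwise that side becomes everything, and both factors at \<open>j\<close>
  are 1.\<close>

lemma product_distribution_fun_upd_0:
  assumes "j < d"
  shows "product_distribution d (p(j := 0)) = distr (product_distribution d p) (bitcube d) (\<lambda>x. x(j := False))"
    (is "_ = ?D")
proof -
  interpret product_prob_space "\<lambda>i. measure_pmf (bernoulli_pmf ((p(j := 0)) i))"
    by unfold_locales auto
  have meas: "(\<lambda>x. x(j := False)) \<in> product_distribution d p \<rightarrow>\<^sub>M bitcube d"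
    using assms by (auto simp: measurable_def sets_product_distribution space_product_distribution
        space_bitcube sets_bitcube PiE_def extensional_def)
  have "?D = PiM {..<d} (\<lambda>i. measure_pmf (bernoulli_pmf ((p(j := 0)) i)))"
  proof (rule PiM_eqI)
    show "sets ?D = sets (Pi\<^sub>M {..<d} (\<lambda>i. measure_pmf (bernoulli_pmf ((p(j := 0)) i))))"
      using sets_product_distribution[of d "p(j := 0)"] by (simp add: product_distribution_def)
    fix A :: "nat \<Rightarrow> bool set"
    have A: "Pi\<^sub>E {..<d} A \<in> sets (bitcube d)"
      by (auto simp: sets_bitcube)
    have pre: "(\<lambda>x. x(j := False)) -` Pi\<^sub>E {..<d} A \<inter> space (product_distribution d p) =
        (if False \<in> A j then Pi\<^sub>E {..<d} (A(j := UNIV)) else {})"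
    proof -
      have upd: "x(j := False) \<in> Pi\<^sub>E {..<d} A \<longleftrightarrow> False \<in> A j \<and> x \<in> Pi\<^sub>E {..<d} (A(j := UNIV))"
        if "x \<in> extensional {..<d}" for x
      proof -
        have "x(j := False) \<in> extensional {..<d}"
          using that assms by (auto simp: extensional_def)
        then show ?thesis
          using that assms by (simp add: PiE_iff Ball_def) (metis UNIV_I)
      qed
      have sp: "space (product_distribution d p) = extensional {..<d}"
        by (auto simp: space_product_distribution PiE_def)
      have sub: "Pi\<^sub>E {..<d} B \<subseteq> extensional {..<d}" for B :: "nat \<Rightarrow> bool set"
        by (auto simp: PiE_def)
      show ?thesis
      proof (cases "False \<in> A j")
        case True
        then show ?thesis unfolding if_P[OF True] sp using upd sub[of "A(j := UNIV)"] by blast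
      next
        case False
        then show ?thesis unfolding if_not_P[OF False] sp using upd by blast
      qed
    qed
    have "measure ?D (Pi\<^sub>E {..<d} A) = measure (product_distribution d p)
        (if False \<in> A j then Pi\<^sub>E {..<d} (A(j := UNIV)) else {})"
      by (simp add: measure_distr[OF meas A] pre)
    also have "\<dots> = (\<Prod>i<d. measure_pmf.prob (bernoulli_pmf ((p(j := 0)) i)) (A i))"
    proof (cases "False \<in> A j")
      case True
      have "measure (product_distribution d p) (Pi\<^sub>E {..<d} (A(j := UNIV))) =
          (\<Prod>i<d. measure_pmf.prob (bernoulli_pmf ((p(j := 0)) i)) (A i))"
        unfolding measure_product_distribution_PiE
        using True by (intro prod.cong refl) (auto simp: bernoulli_pmf_0)
      with True show ?thesis by simp
    next
      case False
      then have "(\<Prod>i<d. measure_pmf.prob (bernoulli_pmf ((p(j := 0)) i)) (A i)) = 0"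
        using assms by (intro prod_zero) (auto simp: bernoulli_pmf_0 intro!: bexI[of _ j])
      with False show ?thesis by simp
    qed
    finally have eq: "measure ?D (Pi\<^sub>E {..<d} A) =
        (\<Prod>i<d. measure_pmf.prob (bernoulli_pmf ((p(j := 0)) i)) (A i))" .
    interpret D: prob_space ?D by (rule prob_space.prob_space_distr[OF prob_space_product_distribution meas])
    show "emeasure ?D (Pi\<^sub>E {..<d} A) = (\<Prod>i<d. emeasure (measure_pmf (bernoulli_pmf ((p(j := 0)) i))) (A i))"
      unfolding D.emeasure_eq_measure eq measure_pmf.emeasure_eq_measure
      by (simp add: prod_ennreal)
  qed simp
  then show ?thesis by (simp add: product_distribution_def)
qed

section \<open>Samples, and clearing one coordinate in every entry\<close>

lemma sets_iid_samples [measurable_cong]: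
  "sets (iid_samples n (product_distribution d p)) = sets (datasets n (bitcube d))"
  unfolding iid_samples_def datasets_def by (intro sets_PiM_cong refl sets_product_distribution)

lemma space_iid_samples:
  "space (iid_samples n (product_distribution d p)) = space (datasets n (bitcube d))"
  by (rule sets_eq_imp_space_eq) (rule sets_iid_samples)

lemma prob_space_iid_samples: "prob_space (iid_samples n (product_distribution d p))"
  unfolding iid_samples_def by (intro prob_space_PiM prob_space_product_distribution)

text \<open>\<open>compose\<close> restricts the result to \<open>{..<n}\<close>, so it is
  extensional, as datasets have to be.\<close>

definition clear_column :: "nat \<Rightarrow> nat \<Rightarrow> (nat \<Rightarrow> nat \<Rightarrow> bool) \<Rightarrow> nat \<Rightarrow> nat \<Rightarrow> bool" where
  "clear_column n j = compose {..<n} (\<lambda>x. x(j := False))"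

lemma measurable_fun_upd_bitcube:
  "j < d \<Longrightarrow> (\<lambda>x. x(j := False)) \<in> bitcube d \<rightarrow>\<^sub>M bitcube d"
  by (auto simp: measurable_def space_bitcube sets_bitcube PiE_def extensional_def)

lemma measurable_clear_column:
  assumes "j < d"
  shows "clear_column n j \<in> datasets n (bitcube d) \<rightarrow>\<^sub>M datasets n (bitcube d)"
  unfolding clear_column_def datasets_def compose_def
  by (intro measurable_restrict measurable_compose[OF _ measurable_fun_upd_bitcube[OF assms]]
      measurable_component_singleton) auto

text \<open>An entrywise map pushes a product measure forward to the product of the pushforwards.
  Since \<open>distr\<close> depends on its target only through the sigma-algebra,
  \<open>bitcube d\<close> and \<open>product_distribution d p\<close> are interchangeable
  there.\<close>

lemma iid_samples_fun_upd_0: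
  assumes "j < d"
  shows "iid_samples n (product_distribution d (p(j := 0))) =
    distr (iid_samples n (product_distribution d p)) (datasets n (bitcube d)) (clear_column n j)"
proof -
  have b: "prob_space (product_distribution d q)" for q by (rule prob_space_product_distribution)
  have "distr (PiM {..<n} (\<lambda>_. product_distribution d p)) (PiM {..<n} (\<lambda>_. product_distribution d p))
      (compose {..<n} (\<lambda>x. x(j := False))) =
    PiM {..<n} (\<lambda>_. distr (product_distribution d p) (product_distribution d p) (\<lambda>x. x(j := False)))"
    using measurable_fun_upd_bitcube[OF assms]
    by (intro distr_PiM_finite_prob_space' b)
      (auto simp: measurable_cong_sets[OF sets_product_distribution sets_product_distribution])
  also have "distr (product_distribution d p) (product_distribution d p) (\<lambda>x. x(j := False)) =
      product_distribution d (p(j := 0))"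
    unfolding product_distribution_fun_upd_0[OF assms]
    by (rule distr_cong) (simp_all add: sets_product_distribution)
  finally have "iid_samples n (product_distribution d (p(j := 0))) =
      distr (iid_samples n (product_distribution d p)) (iid_samples n (product_distribution d p)) (clear_column n j)"
    unfolding iid_samples_def clear_column_def by (rule sym)
  also have "\<dots> = distr (iid_samples n (product_distribution d p)) (datasets n (bitcube d)) (clear_column n j)"
    by (rule distr_cong) (simp_all add: sets_iid_samples)
  finally show ?thesis .
qed

lemma sets_entry:
  assumes "i < n" "j < d"
  shows "{X \<in> space (datasets n (bitcube d)). X i j} \<in> sets (datasets n (bitcube d))"
proof -
  have "(\<lambda>X. X i j) \<in> datasets n (bitcube d) \<rightarrow>\<^sub>M count_space UNIV"
    unfolding datasets_def using assms
    by (intro measurable_compose[of "\<lambda>X. X i" _ "bitcube d" "\<lambda>x. x j"] measurable_component_singleton)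
      (auto simp: bitcube_def)
  then show ?thesis by measurable
qed

text \<open>Projecting first to entry \<open>i\<close> and then to coordinate \<open>j\<close>
  leaves a Bernoulli law with parameter \<open>p j\<close>.\<close>

lemma iid_samples_entry_prob:
  assumes "i < n" "j < d" "0 \<le> p j" "p j \<le> 1"
  shows "measure (iid_samples n (product_distribution d p)) {X \<in> space (datasets n (bitcube d)). X i j} = p j"
proof -
  have 1: "distr (iid_samples n (product_distribution d p)) (product_distribution d p) (\<lambda>X. X i) = product_distribution d p"
    unfolding iid_samples_def
    using distr_PiM_component[of "{..<n}" "\<lambda>_. product_distribution d p" i] assms
    by (simp add: prob_space_product_distribution)
  have 2: "distr (product_distribution d p) (bernoulli_pmf (p j)) (\<lambda>x. x j) = bernoulli_pmf (p j)"
    unfolding product_distribution_def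
    using distr_PiM_component[of "{..<d}" "\<lambda>j. measure_pmf (bernoulli_pmf (p j))" j] assms
    by (simp add: prob_space_measure_pmf)
  have m1: "(\<lambda>X. X i) \<in> iid_samples n (product_distribution d p) \<rightarrow>\<^sub>M product_distribution d p"
    unfolding iid_samples_def using assms by simp
  have m2: "(\<lambda>x. x j) \<in> product_distribution d p \<rightarrow>\<^sub>M measure_pmf (bernoulli_pmf (p j))"
    unfolding product_distribution_def using assms by (intro measurable_component_singleton) auto
  have "p j = measure (bernoulli_pmf (p j)) {True}"
    using assms by (simp add: measure_pmf_single)
  also have "\<dots> = measure (product_distribution d p) ((\<lambda>x. x j) -` {True} \<inter> space (product_distribution d p))"
    by (subst 2[symmetric], subst measure_distr[OF m2]) auto
  also have "\<dots> = measure (iid_samples n (product_distribution d p)) ((\<lambda>X. X i) -` ((\<lambda>x. x j) -` {True} \<inter> space (product_distribution d p))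
      \<inter> space (iid_samples n (product_distribution d p)))"
    by (subst 1[symmetric], subst measure_distr[OF m1]) (auto intro!: measurable_sets[OF m2])
  also have "((\<lambda>X. X i) -` ((\<lambda>x. x j) -` {True} \<inter> space (product_distribution d p))
      \<inter> space (iid_samples n (product_distribution d p))) = {X \<in> space (datasets n (bitcube d)). X i j}"
    using measurable_space[OF m1] by (auto simp: space_iid_samples)
  finally show ?thesis by simp
qed

section \<open>Privacy as a Lipschitz condition in Hamming distance\<close>

text \<open>Trading the factor \<open>exp \<epsilon>\<close> for an additive loss lets losses add up
  over many steps instead of compounding. For \<epsilon> \<le> 1 this is exp \<epsilon> \<le> 1 + 2
  \<epsilon> applied to a probability; for larger \<epsilon> the slack alone exceeds 1.\<close>

lemma differentially_private_one_step:
  assumes dp: "differentially_private n D R \<epsilon> \<delta> M" and "0 < \<epsilon>" "0 \<le> \<delta>"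
    and M: "mechanism n D R M"
    and X: "X \<in> space (datasets n D)" "X' \<in> space (datasets n D)" "neighboring n X X'" and "Y \<in> sets R"
  shows "measure (M X) Y \<le> measure (M X') Y + (2 * \<epsilon> + \<delta>)"
proof -
  have "prob_space (M X)" "prob_space (M X')"
    using M X measurable_space[of M "datasets n D" "prob_algebra R"]
    by (auto simp: mechanism_def space_prob_algebra)
  then have b: "measure (M X) Y \<le> 1" "measure (M X') Y \<le> 1"
    by (auto simp: prob_space.prob_le_1)
  have d: "measure (M X) Y \<le> exp \<epsilon> * measure (M X') Y + \<delta>"
    using dp X \<open>Y \<in> sets R\<close> by (auto simp: differentially_private_def)
  show ?thesis
  proof (cases "\<epsilon> \<le> 1")
    case True
    have "exp \<epsilon> \<le> 1 + \<epsilon> + \<epsilon>\<^sup>2"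
      using exp_bound[of \<epsilon>] True assms by simp
    also have "\<dots> \<le> 1 + 2 * \<epsilon>"
      using True assms by (simp add: power2_eq_square)
    finally have "(exp \<epsilon> - 1) * measure (M X') Y \<le> 2 * \<epsilon> * 1"
      using b assms by (intro mult_mono) auto
    with d show ?thesis by (simp add: algebra_simps)
  next
    case False
    then show ?thesis using b assms measure_nonneg[of "M X'" Y] by linarith
  qed
qed

lemma differentially_private_hamming:
  assumes dp: "differentially_private n D R \<epsilon> \<delta> M" "0 < \<epsilon>" "0 \<le> \<delta>" "mechanism n D R M"
    and X: "X \<in> space (datasets n D)" and X': "X' \<in> space (datasets n D)" and Y: "Y \<in> sets R"
  shows "measure (M X) Y \<le> measure (M X') Y + real (card {i \<in> {..<n}. X i \<noteq> X' i}) * (2 * \<epsilon> + \<delta>)"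
  using X'
proof (induction "card {i \<in> {..<n}. X i \<noteq> X' i}" arbitrary: X')
  case 0
  \<comment> \<open>Agreement on \<open>{..<n}\<close> is equality because both datasets are
    extensional.\<close>
  then have "X = X'"
    using X by (auto simp: datasets_def space_PiM PiE_def intro!: extensionalityI[of X "{..<n}" X'])
  then show ?case by simp
next
  case (Suc k)
  then obtain i where i: "i < n" "X i \<noteq> X' i"
    by (metis (mono_tags, lifting) card.empty empty_Collect_eq lessThan_iff nat.distinct(1))
  \<comment> \<open>Copying one differing entry from \<open>X\<close> gives a neighbor of
    \<open>X'\<close> that is one step closer to \<open>X\<close>.\<close>
  define X'' where "X'' = X'(i := X i)"
  have X'': "X'' \<in> space (datasets n D)"
    using Suc.prems X i by (auto simp: X''_def datasets_def space_PiM PiE_def extensional_def)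
  have "{l \<in> {..<n}. X l \<noteq> X'' l} = {l \<in> {..<n}. X l \<noteq> X' l} - {i}"
    using i by (auto simp: X''_def)
  then have k: "k = card {l \<in> {..<n}. X l \<noteq> X'' l}"
    using Suc.hyps(2) i by simp
  have "{l \<in> {..<n}. X'' l \<noteq> X' l} = {i}"
    using i by (auto simp: X''_def)
  then have "neighboring n X'' X'" by (simp add: neighboring_def)
  from differentially_private_one_step[OF dp X'' Suc.prems this Y] Suc.hyps(1)[OF k X'']
  show ?case unfolding k[symmetric] Suc.hyps(2)[symmetric] by (simp add: algebra_simps)
qed

section \<open>Law of the output and its change under clearing a column\<close>

lemma measure_bind_mechanism:
  assumes "mechanism n (bitcube d) R M" "Y \<in> sets R"
  shows "measure (iid_samples n (product_distribution d p) \<bind> M) Y =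
    (\<integral>X. measure (M X) Y \<partial>iid_samples n (product_distribution d p))"
proof -
  interpret prob_space "iid_samples n (product_distribution d p)" by (rule prob_space_iid_samples)
  show ?thesis
    using assms by (intro measure_bind[where N=R])
      (auto simp: mechanism_def measurable_cong_sets[OF sets_iid_samples refl] intro: measurable_prob_algebraD)
qed

lemma bind_mechanism_in_prob_algebra:
  assumes "mechanism n (bitcube d) R M"
  shows "iid_samples n (product_distribution d p) \<bind> M \<in> space (prob_algebra R)"
proof -
  let ?P = "iid_samples n (product_distribution d p)"
  interpret prob_space ?P by (rule prob_space_iid_samples)
  have M: "M \<in> ?P \<rightarrow>\<^sub>M prob_algebra R"
    using assms by (simp add: mechanism_def measurable_cong_sets[OF sets_iid_samples refl])
  then have "prob_space (?P \<bind> M)"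
    using measurable_space[OF M]
    by (intro prob_space_bind[where S=R] AE_I2) (auto simp: space_prob_algebra intro: measurable_prob_algebraD)
  moreover have "sets (?P \<bind> M) = sets R"
    using measurable_space[OF M] by (intro sets_bind not_empty) (auto simp: space_prob_algebra)
  ultimately show ?thesis by (simp add: space_prob_algebra)
qed

text \<open>A coupling: a sample \<open>X\<close> and its cleared version have the two required laws
  and differ exactly in the entries with bit \<open>j\<close> set. Integrating the Hamming bound
  leaves the expected number of such entries, \<open>n * p j\<close>.\<close>

lemma clear_column_privacy:
  assumes dp: "differentially_private n (bitcube d) R \<epsilon> \<delta> M" "0 < \<epsilon>" "0 \<le> \<delta>"
    and M: "mechanism n (bitcube d) R M"
    and Y: "Y \<in> sets R" and j: "j < d" "0 \<le> p j" "p j \<le> 1"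
  shows "measure (iid_samples n (product_distribution d p) \<bind> M) Y \<le>
    measure (iid_samples n (product_distribution d (p(j := 0))) \<bind> M) Y + real n * p j * (2 * \<epsilon> + \<delta>)"
proof -
  let ?P = "iid_samples n (product_distribution d p)"
  interpret prob_space ?P by (rule prob_space_iid_samples)
  have f: "(\<lambda>X. measure (M X) Y) \<in> borel_measurable (datasets n (bitcube d))"
    using M Y by (auto simp: mechanism_def intro: measure_measurable_prob_algebra2)
  have bd: "measure (M X) Y \<le> 1" if "X \<in> space (datasets n (bitcube d))" for X
    using M that measurable_space[of M "datasets n (bitcube d)" "prob_algebra R" X]
    by (auto simp: mechanism_def space_prob_algebra prob_space.prob_le_1)
  have c: "clear_column n j \<in> ?P \<rightarrow>\<^sub>M datasets n (bitcube d)"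
    using measurable_clear_column[OF j(1)] by (simp add: measurable_cong_sets[OF sets_iid_samples refl])
  have int1: "integrable ?P (\<lambda>X. measure (M X) Y)"
    using f bd by (intro integrable_const_bound[where B=1])
      (auto simp: measurable_cong_sets[OF sets_iid_samples refl] space_iid_samples intro!: AE_I2)
  have int2: "integrable ?P (\<lambda>X. measure (M (clear_column n j X)) Y)"
    using measurable_compose[OF c f] measurable_space[OF c] bd
    by (intro integrable_const_bound[where B=1]) (auto intro!: AE_I2)
  have entry: "{X \<in> space (datasets n (bitcube d)). X i j} \<in> events" if "i < n" for i
    using sets_entry[OF that j(1)] by (simp add: sets_iid_samples)
  have int3: "integrable ?P (indicator {X \<in> space (datasets n (bitcube d)). X i j} :: _ \<Rightarrow> real)" if "i < n" for i
    using entry[OF that] by (simp add: integrable_indicator_iff less_top[symmetric])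
  have "measure (?P \<bind> M) Y = (\<integral>X. measure (M X) Y \<partial>?P)"
    by (rule measure_bind_mechanism[OF M Y])
  also have "\<dots> \<le> (\<integral>X. measure (M (clear_column n j X)) Y +
      (\<Sum>i<n. indicator {X \<in> space (datasets n (bitcube d)). X i j} X * (2 * \<epsilon> + \<delta>)) \<partial>?P)"
  proof (rule integral_mono)
    fix X assume "X \<in> space ?P"
    then have X: "X \<in> space (datasets n (bitcube d))" by (simp add: space_iid_samples)
    have "{i \<in> {..<n}. X i \<noteq> clear_column n j X i} = {i \<in> {..<n}. X i j}"
      by (auto simp: clear_column_def compose_def fun_eq_iff)
    then have "real (card {i \<in> {..<n}. X i \<noteq> clear_column n j X i}) =
        (\<Sum>i<n. indicator {X \<in> space (datasets n (bitcube d)). X i j} X)"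
      using X by (simp add: indicator_def of_bool_def sum.If_cases Int_def conj_commute)
    with differentially_private_hamming[OF dp M X measurable_space[OF measurable_clear_column[OF j(1)] X] Y]
    show "measure (M X) Y \<le> measure (M (clear_column n j X)) Y +
      (\<Sum>i<n. indicator {X \<in> space (datasets n (bitcube d)). X i j} X * (2 * \<epsilon> + \<delta>))"
      by (simp add: sum_distrib_right)
  next
    show "integrable ?P (\<lambda>X. measure (M (clear_column n j X)) Y +
        (\<Sum>i<n. indicator {X \<in> space (datasets n (bitcube d)). X i j} X * (2 * \<epsilon> + \<delta>)))"
      using int2 int3
      by (intro Bochner_Integration.integrable_add Bochner_Integration.integrable_sum integrable_mult_left impI) auto
  qed (rule int1)
  also have "\<dots> = (\<integral>X. measure (M (clear_column n j X)) Y \<partial>?P) + real n * p j * (2 * \<epsilon> + \<delta>)"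
  proof -
    have "(\<integral>X. indicator {X \<in> space (datasets n (bitcube d)). X i j} X \<partial>?P) = p j" if "i < n" for i
      using iid_samples_entry_prob[OF that j(1), of p] j entry[OF that] by simp
    then have "(\<Sum>i<n. \<integral>X. indicator {X \<in> space (datasets n (bitcube d)). X i j} X * (2 * \<epsilon> + \<delta>) \<partial>?P) =
        real n * p j * (2 * \<epsilon> + \<delta>)" by simp
    moreover have "integrable ?P (\<lambda>X. indicator {X \<in> space (datasets n (bitcube d)). X i j} X * (2 * \<epsilon> + \<delta>))"
      if "i \<in> {..<n}" for i
      using int3 that by (intro integrable_mult_left impI) simp
    ultimately show ?thesis
      using int2 by (simp only: Bochner_Integration.integral_add Bochner_Integration.integral_sum Bochner_Integration.integrable_sum)
  qed
  also have "(\<integral>X. measure (M (clear_column n j X)) Y \<partial>?P) =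
      measure (iid_samples n (product_distribution d (p(j := 0))) \<bind> M) Y"
    unfolding measure_bind_mechanism[OF M Y] unfolding iid_samples_fun_upd_0[OF j(1)]
    by (rule integral_distr[OF c f, symmetric])
  finally show ?thesis .
qed

section \<open>Separation in total variation\<close>

text \<open>A real supremum is known to dominate its members only over a bounded set; here
  differences of probabilities are at most 1.\<close>

lemma tv_dist_le_imp:
  assumes Q: "Q \<in> space (prob_algebra (bitcube d))" and E: "E \<in> sets (bitcube d)"
    and tv: "tv_dist Q (product_distribution d p) \<le> \<alpha>"
  shows "\<bar>measure Q E - measure (product_distribution d p) E\<bar> \<le> \<alpha>"
proof -
  let ?P = "product_distribution d p"
  have "prob_space Q" and sQ: "sets Q = sets (bitcube d)"
    using Q by (auto simp: space_prob_algebra)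
  then have "\<bar>measure Q A - measure ?P A\<bar> \<le> 1" for A
    using prob_space.prob_le_1[of Q A] prob_space.prob_le_1[OF prob_space_product_distribution, of d p A]
      measure_nonneg[of Q A] measure_nonneg[of ?P A] by linarith
  then have "bdd_above ((\<lambda>A. \<bar>measure Q A - measure ?P A\<bar>) ` sets Q)"
    by (auto intro!: bdd_aboveI)
  then have "\<bar>measure Q E - measure ?P E\<bar> \<le> tv_dist Q ?P"
    unfolding tv_dist_def using E sQ by (intro cSUP_upper) auto
  with tv show ?thesis by simp
qed

text \<open>The complement of the event is a box, with side \<open>{False}\<close> at each
  coordinate in \<open>A\<close>.\<close>

lemma measure_product_distribution_Bex:
  assumes "A \<subseteq> {..<d}" "\<And>j. 0 \<le> p j" "\<And>j. p j \<le> 1"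
  shows "measure (product_distribution d p) {x \<in> space (bitcube d). \<exists>j\<in>A. x j} = 1 - (\<Prod>j\<in>A. 1 - p j)"
proof -
  interpret prob_space "product_distribution d p" by (rule prob_space_product_distribution)
  let ?B = "Pi\<^sub>E {..<d} (\<lambda>j. if j \<in> A then {False} else UNIV)"
  have "{x \<in> space (bitcube d). \<exists>j\<in>A. x j} = space (product_distribution d p) - ?B"
    using assms(1) by (fastforce simp: space_bitcube space_product_distribution PiE_iff extensional_def split: if_splits)
  then have "measure (product_distribution d p) {x \<in> space (bitcube d). \<exists>j\<in>A. x j} = 1 - prob ?B"
    by (simp add: prob_compl sets_product_distribution sets_bitcube PiE_mono)
  also have "prob ?B = (\<Prod>j<d. if j \<in> A then 1 - p j else 1)"
    unfolding measure_product_distribution_PiE using assms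
    by (intro prod.cong refl) (auto simp: measure_pmf_single)
  also have "\<dots> = (\<Prod>j\<in>A. 1 - p j)"
    using assms(1) by (simp add: prod.If_cases Int_absorb1)
  finally show ?thesis .
qed

text \<open>With u = a g, Bernoulli's inequality gives (1 - g)^a (1 + u) \<le> (1 - g^2)^a \<le> 1,
  and 1 \<le> (1 - u/2) (1 + u) because 0 \<le> u \<le> 1. Cancel 1 + u.\<close>

lemma one_minus_power_le:
  fixes g :: real
  assumes "0 \<le> g" "real a * g \<le> 1"
  shows "(1 - g) ^ a \<le> 1 - real a * g / 2"
proof (cases "a = 0")
  case False
  then have "1 * g \<le> real a * g"
    using assms by (intro mult_right_mono) auto
  then have g: "g \<le> 1" using assms by simp
  let ?u = "real a * g"
  have "(1 - g) ^ a * (1 + ?u) \<le> (1 - g) ^ a * (1 + g) ^ a"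
    using Bernoulli_inequality[of g a] assms g by (intro mult_left_mono) auto
  also have "\<dots> = (1 - g\<^sup>2) ^ a"
    by (simp add: power_mult_distrib[symmetric] power2_eq_square algebra_simps)
  also have "\<dots> \<le> 1"
    using assms g by (intro power_le_one) (auto simp: power_le_one)
  also have "\<dots> \<le> (1 - ?u / 2) * (1 + ?u)"
  proof -
    have "0 \<le> ?u * (1 - ?u)" using assms by (intro mult_nonneg_nonneg) auto
    then show ?thesis by (simp add: algebra_simps)
  qed
  finally show ?thesis
    by (rule mult_right_le_imp_le) (use assms in \<open>simp add: add_pos_nonneg\<close>)
qed simp

text \<open>Biases near 0 rather than 1/2 make a coordinate cheap to switch off: only
  \<open>n * g\<close> entries change in expectation.\<close>

definition sparse_bias :: "real \<Rightarrow> nat set \<Rightarrow> nat \<Rightarrow> real" where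
  "sparse_bias g S j = (if j \<in> S then g else 0)"

text \<open>The event that some coordinate of \<open>S - T\<close> is set separates the two product distributions.\<close>

lemma card_Diff_le_if_tv_close:
  assumes Q: "Q \<in> space (prob_algebra (bitcube d))"
    and S: "S \<subseteq> {..<d}" and g: "0 \<le> g" "real d * g \<le> 1"
    and tvS: "tv_dist Q (product_distribution d (sparse_bias g S)) \<le> \<alpha>"
    and tvT: "tv_dist Q (product_distribution d (sparse_bias g T)) \<le> \<alpha>"
  shows "real (card (S - T)) * g \<le> 4 * \<alpha>"
proof (cases "S - T = {}")
  case True
  \<comment> \<open>The left-hand side of the goal is 0 here; testing closeness on the empty event
    shows that \<alpha> is nonnegative.\<close>
  have "0 \<le> \<alpha>"
    using tv_dist_le_imp[OF Q _ tvS, of "{}"] by simp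
  then show ?thesis unfolding True by simp
next
  case False
  then have "0 < d" using S by auto
  then have "1 * g \<le> real d * g"
    using g by (intro mult_right_mono) auto
  then have g1: "g \<le> 1" using g by simp
  let ?E = "{x \<in> space (bitcube d). \<exists>j\<in>S - T. x j}"
  have E: "?E \<in> sets (bitcube d)" by (auto simp: sets_bitcube space_bitcube)
  have "card (S - T) \<le> d"
    using card_mono[of "{..<d}" "S - T"] S by auto
  then have "real (card (S - T)) * g \<le> real d * g"
    using g by (intro mult_right_mono) auto
  then have a: "real (card (S - T)) * g \<le> 1" using g by simp
  have "measure (product_distribution d (sparse_bias g S)) ?E = 1 - (1 - g) ^ card (S - T)"
    using S g g1 by (subst measure_product_distribution_Bex) (auto simp: sparse_bias_def)
  moreover have "measure (product_distribution d (sparse_bias g T)) ?E = 0"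
    using S g g1 by (subst measure_product_distribution_Bex) (auto simp: sparse_bias_def)
  \<comment> \<open>The first probability is at least half of \<open>card (S - T) * g\<close>, the
    second is 0, and both lie within \<alpha> of \<open>measure Q ?E\<close>; hence that half is at
    most 2 \<alpha>.\<close>
  ultimately show ?thesis
    using one_minus_power_le[OF g(1) a] tv_dist_le_imp[OF Q E tvS] tv_dist_le_imp[OF Q E tvT] by linarith
qed

section \<open>Averaging over edges of the cube of subsets\<close>

text \<open>The factor two comes from summing over both endpoints of every edge in direction \<open>j\<close>.\<close>

lemma sum_Pow_pairs_ge:
  fixes f :: "nat set \<Rightarrow> real"
  assumes j: "j < d" and pair: "\<And>S. S \<subseteq> {..<d} \<Longrightarrow> j \<in> S \<Longrightarrow> c \<le> f S + f (S - {j})"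
  shows "2 ^ d * c \<le> 2 * (\<Sum>S\<in>Pow {..<d}. f S)"
proof -
  \<comment> \<open>Toggling \<open>j\<close> is an involution of the subsets of
    \<open>{..<d}\<close>, so it permutes the sum.\<close>
  define t where "t S = (if j \<in> S then S - {j} else insert j S)" for S
  have "(\<Sum>S\<in>Pow {..<d}. f (t S)) = (\<Sum>S\<in>Pow {..<d}. f S)"
    by (rule sum.reindex_bij_witness[of _ t t]) (use j in \<open>auto simp: t_def split: if_splits\<close>)
  then have "2 * (\<Sum>S\<in>Pow {..<d}. f S) = (\<Sum>S\<in>Pow {..<d}. f S + f (t S))"
    by (simp add: sum.distrib)
  also have "\<dots> \<ge> (\<Sum>S\<in>Pow {..<d}. c)"
  proof (rule sum_mono)
    fix S assume S: "S \<in> Pow {..<d}"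
    show "c \<le> f S + f (t S)"
    proof (cases "j \<in> S")
      case True
      then show ?thesis using pair[of S] S by (simp add: t_def)
    next
      case False
      then show ?thesis using pair[of "insert j S"] S j by (simp add: t_def add.commute)
    qed
  qed
  finally show ?thesis by (simp add: card_Pow)
qed

section \<open>Decoding error, bounded from both sides\<close>

lemma private_estimation_bound:
  assumes \<alpha>: "0 < \<alpha>" "\<alpha> \<le> 1 / 96" and \<epsilon>: "0 < \<epsilon>" and d: "1 \<le> d" and n: "1 \<le> n"
    and M: "mechanism n (bitcube d) (prob_algebra (bitcube d)) M"
    and dp: "differentially_private n (bitcube d) (prob_algebra (bitcube d)) \<epsilon> (3 / (64 * real n)) M"
    and est: "estimates_product_distributions n d \<alpha> (2 / 3) M"
  shows "real d \<le> 1920 * (real n * \<alpha> * \<epsilon>)"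
proof -
  \<comment> \<open>The factor 96 makes the decoding error 8 \<alpha> / g equal to d / 12, and
    \<alpha> \<le> 1/96 then ensures d g \<le> 1.\<close>
  define g where "g = 96 * \<alpha> / real d"
  have dg: "real d * g = 96 * \<alpha>" using d by (simp add: g_def)
  have g0: "0 \<le> g" using \<alpha> by (simp add: g_def)
  have dg1: "real d * g \<le> 1" using \<alpha> dg by simp
  have "1 * g \<le> real d * g" using d g0 by (intro mult_right_mono) auto
  then have g1: "g \<le> 1" using dg1 by simp
  let ?R = "prob_algebra (bitcube d)"
  define G where "G S = {Q \<in> space ?R. tv_dist Q (product_distribution d (sparse_bias g S)) \<le> \<alpha>}" for S
  define \<mu> where "\<mu> S = iid_samples n (product_distribution d (sparse_bias g S)) \<bind> M" for S
  have \<mu>: "prob_space (\<mu> S)" and sets_\<mu>: "sets (\<mu> S) = sets ?R" for S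
    using bind_mechanism_in_prob_algebra[OF M] by (auto simp: \<mu>_def space_prob_algebra)
  have space_\<mu>: "space (\<mu> S) = space ?R" for S
    by (rule sets_eq_imp_space_eq) (rule sets_\<mu>)
  have muG: "2 / 3 \<le> measure (\<mu> S) (G S)" for S
    using est g0 g1 unfolding estimates_product_distributions_def G_def \<mu>_def
    by (auto simp: sparse_bias_def)
  \<comment> \<open>A nonmeasurable set has measure \<open>0\<close>, so the accuracy assumption forces measurability.\<close>
  have G: "G S \<in> sets ?R" for S
  proof (rule ccontr)
    assume "G S \<notin> sets ?R"
    then have "measure (\<mu> S) (G S) = 0" by (simp add: measure_notin_sets sets_\<mu>)
    with muG[of S] show False by simp
  qed
  \<comment> \<open>The decoder depends on \<open>Q\<close> only through the finite set \<open>code Q\<close>, hence is measurable; its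
    value is irrelevant when \<open>code Q\<close> is empty.\<close>
  define code where "code Q = {T \<in> Pow {..<d}. Q \<in> G T}" for Q
  define dec where "dec Q = (SOME T. T \<in> code Q)" for Q
  have code: "code \<in> ?R \<rightarrow>\<^sub>M count_space (Pow (Pow {..<d}))"
  proof (rule measurable_count_space_eq2[THEN iffD2])
    show "code \<in> space ?R \<rightarrow> Pow (Pow {..<d}) \<and> (\<forall>F\<in>Pow (Pow {..<d}). code -` {F} \<inter> space ?R \<in> sets ?R)"
    proof (intro conjI ballI)
      fix F assume F: "F \<in> Pow (Pow {..<d})"
      \<comment> \<open>A fiber of \<open>code\<close> is cut out by finitely many conditions on
        membership in the measurable sets \<open>G T\<close>.\<close>
      have "code -` {F} \<inter> space ?R = {Q \<in> space ?R. \<forall>T\<in>Pow {..<d}. Q \<in> G T \<longleftrightarrow> T \<in> F}"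
      proof -
        have "code Q = F \<longleftrightarrow> (\<forall>T\<in>Pow {..<d}. Q \<in> G T \<longleftrightarrow> T \<in> F)" for Q
          using F unfolding code_def set_eq_iff by blast
        then show ?thesis by blast
      qed
      also have "\<dots> \<in> sets ?R"
        using G by (intro sets.sets_Collect_finite_All) auto
      finally show "code -` {F} \<inter> space ?R \<in> sets ?R" .
    qed (auto simp: code_def)
  qed simp
  have Y: "{Q \<in> space ?R. P (dec Q)} \<in> sets ?R" for P
  proof -
    have "{Q \<in> space ?R. P (dec Q)} = code -` {F \<in> Pow (Pow {..<d}). P (SOME T. T \<in> F)} \<inter> space ?R"
      by (auto simp: dec_def code_def)
    also have "\<dots> \<in> sets ?R"
      by (rule measurable_sets[OF code]) auto
    finally show ?thesis .
  qed
  define err where "err S j = measure (\<mu> S) {Q \<in> space ?R. (j \<in> dec Q) \<noteq> (j \<in> S)}" for S j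
  have err_le: "(\<Sum>j<d. err S j) \<le> 5 / 12 * real d" if S: "S \<subseteq> {..<d}" for S
  proof -
    interpret prob_space "\<mu> S" by (rule \<mu>)
    let ?W = "\<lambda>j. {Q \<in> space ?R. (j \<in> dec Q) \<noteq> (j \<in> S)}"
    have W: "?W j \<in> events" for j using Y by (simp add: sets_\<mu>)
    have GC: "space ?R - G S \<in> events" using G by (simp add: sets_\<mu>)
    have "(\<Sum>j<d. err S j) = (\<integral>Q. (\<Sum>j<d. indicator (?W j) Q) \<partial>\<mu> S)"
      using W by (subst Bochner_Integration.integral_sum) (auto simp: err_def integrable_indicator_iff less_top[symmetric])
    \<comment> \<open>On \<open>G S\<close> both \<open>S\<close> and \<open>dec Q\<close> are close
      to \<open>Q\<close>, so at most d / 12 coordinates are wrong; off \<open>G S\<close>, of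
      probability at most 1/3, the trivial bound d is used.\<close>
    also have "\<dots> \<le> (\<integral>Q. real d / 12 + real d * indicator (space ?R - G S) Q \<partial>\<mu> S)"
    proof (rule integral_mono)
      fix Q assume "Q \<in> space (\<mu> S)"
      then have Q: "Q \<in> space ?R" by (simp add: space_\<mu>)
      have W_card: "(\<Sum>j<d. indicator (?W j) Q) = real (card {j \<in> {..<d}. (j \<in> dec Q) \<noteq> (j \<in> S)})"
        using Q by (simp add: indicator_def of_bool_def sum.If_cases Int_def)
      show "(\<Sum>j<d. indicator (?W j) Q) \<le> real d / 12 + real d * indicator (space ?R - G S) Q"
      proof (cases "Q \<in> G S")
        case True
        then have "S \<in> code Q" using S by (simp add: code_def)
        then have "dec Q \<in> code Q" unfolding dec_def by (rule someI)
        then have dec: "dec Q \<subseteq> {..<d}" "tv_dist Q (product_distribution d (sparse_bias g (dec Q))) \<le> \<alpha>"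
          by (auto simp: code_def G_def)
        have tv: "tv_dist Q (product_distribution d (sparse_bias g S)) \<le> \<alpha>"
          using True by (simp add: G_def)
        have "card {j \<in> {..<d}. (j \<in> dec Q) \<noteq> (j \<in> S)} \<le> card ((S - dec Q) \<union> (dec Q - S))"
          using S dec finite_subset[OF S] finite_subset[OF dec(1)] by (intro card_mono) auto
        also have "\<dots> \<le> card (S - dec Q) + card (dec Q - S)" by (rule card_Un_le)
        finally have "real (card {j \<in> {..<d}. (j \<in> dec Q) \<noteq> (j \<in> S)}) * g \<le>
            (real (card (S - dec Q)) + real (card (dec Q - S))) * g"
          using g0 by (intro mult_right_mono) auto
        also have "\<dots> \<le> 8 * \<alpha>"
          using card_Diff_le_if_tv_close[OF Q S g0 dg1 tv dec(2)]
            card_Diff_le_if_tv_close[OF Q dec(1) g0 dg1 dec(2) tv] by (simp add: distrib_right)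
        also have "\<dots> = real d / 12 * g" using dg by simp
        finally have "real (card {j \<in> {..<d}. (j \<in> dec Q) \<noteq> (j \<in> S)}) \<le> real d / 12"
          by (rule mult_right_le_imp_le) (use \<alpha> d in \<open>simp add: g_def\<close>)
        with True show ?thesis unfolding W_card by simp
      next
        case False
        have "card {j \<in> {..<d}. (j \<in> dec Q) \<noteq> (j \<in> S)} \<le> card {..<d}" by (intro card_mono) auto
        with False Q show ?thesis unfolding W_card by simp
      qed
    qed (use W GC in \<open>auto simp: integrable_indicator_iff less_top[symmetric]\<close>)
    also have "\<dots> = real d / 12 + real d * prob (space ?R - G S)"
      using GC by (simp add: prob_space integrable_indicator_iff less_top[symmetric])
    also have "prob (space ?R - G S) = 1 - prob (G S)"
      using prob_compl[of "G S"] G by (simp add: space_\<mu> sets_\<mu>)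
    also have "real d / 12 + real d * (1 - prob (G S)) \<le> real d / 12 + real d * (1 / 3)"
      using muG[of S] by (intro add_left_mono mult_left_mono) auto
    finally show ?thesis by simp
  qed
  define \<eta> where "\<eta> = real n * g * (2 * \<epsilon> + 3 / (64 * real n))"
  \<comment> \<open>Both errors concern the single event that \<open>dec Q\<close> contains
    \<open>j\<close>: under \<open>S\<close> the error is its complement, under
    \<open>S - {j}\<close> the event itself. Privacy makes its probability drop by at most
    \<open>\<eta>\<close> when column \<open>j\<close> is cleared.\<close>
  have err_ge: "1 - \<eta> \<le> err S j + err (S - {j}) j" if j: "j < d" "j \<in> S" for S j
  proof -
    interpret prob_space "\<mu> S" by (rule \<mu>)
    let ?Y = "{Q \<in> space ?R. j \<in> dec Q}"
    have "(sparse_bias g S)(j := 0) = sparse_bias g (S - {j})"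
      by (auto simp: sparse_bias_def)
    then have "prob ?Y \<le> measure (\<mu> (S - {j})) ?Y + \<eta>"
      using clear_column_privacy[OF dp \<epsilon> _ M Y j(1), of "sparse_bias g S" "\<lambda>T. j \<in> T"] j g0 g1
      by (simp add: \<mu>_def \<eta>_def sparse_bias_def)
    moreover have "err (S - {j}) j = measure (\<mu> (S - {j})) ?Y"
      by (simp add: err_def)
    moreover have "err S j = 1 - prob ?Y"
    proof -
      have "{Q \<in> space ?R. (j \<in> dec Q) \<noteq> (j \<in> S)} = space (\<mu> S) - ?Y"
        using j by (auto simp: space_\<mu>)
      then show ?thesis using prob_compl[of ?Y] Y by (simp add: err_def sets_\<mu>)
    qed
    ultimately show ?thesis by simp
  qed
  have "real d * (2 ^ d * (1 - \<eta>)) = (\<Sum>j<d. 2 ^ d * (1 - \<eta>))" by simp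
  also have "\<dots> \<le> (\<Sum>j<d. 2 * (\<Sum>S\<in>Pow {..<d}. err S j))"
    using err_ge by (intro sum_mono sum_Pow_pairs_ge) auto
  also have "\<dots> = 2 * (\<Sum>S\<in>Pow {..<d}. \<Sum>j<d. err S j)"
    by (subst sum.swap) (simp add: sum_distrib_left)
  also have "\<dots> \<le> 2 * (\<Sum>S\<in>Pow {..<d}. 5 / 12 * real d)"
    using err_le by (intro mult_left_mono sum_mono) auto
  also have "\<dots> = real d * (2 ^ d * (5 / 6))" by (simp add: card_Pow)
  \<comment> \<open>Cancelling \<open>d * 2 ^ d\<close> leaves
    \<open>1 - \<eta> \<le> 5 / 6\<close>.\<close>
  finally have "1 / 6 \<le> \<eta>" using d by simp
  then have "real d * (1 / 6) \<le> real d * \<eta>" by (intro mult_left_mono) auto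
  also have "\<dots> = real n * (96 * \<alpha>) * (2 * \<epsilon> + 3 / (64 * real n))"
    unfolding \<eta>_def dg[symmetric] by (simp add: algebra_simps)
  also have "\<dots> = 192 * (real n * \<alpha> * \<epsilon>) + 9 / 2 * \<alpha>"
    using n by (simp add: field_simps)
  \<comment> \<open>The privacy slack contributes 9/2 \<alpha> \<le> 3/64 \<le> d / 15, and 1/6 -
    1/15 = 1/10, whence the constant 10 * 192 = 1920.\<close>
  finally show ?thesis using \<alpha> d by simp
qed

theorem theorem6p1:
  "\<exists>\<alpha>\<^sub>0 c :: real. 0 < \<alpha>\<^sub>0 \<and> 0 < c \<and>
     (\<forall>(\<alpha>::real) (\<epsilon>::real) (d::nat) (n::nat) M.
        0 < \<alpha> \<longrightarrow> \<alpha> \<le> 1 \<longrightarrow> \<alpha> < \<alpha>\<^sub>0 \<longrightarrow> 0 < \<epsilon> \<longrightarrow> 2 \<le> d \<longrightarrow> 1 \<le> n \<longrightarrow>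
        mechanism n (bitcube d) (prob_algebra (bitcube d)) M \<longrightarrow>
        differentially_private n (bitcube d) (prob_algebra (bitcube d)) \<epsilon> (3 / (64 * real n)) M \<longrightarrow>
        estimates_product_distributions n d \<alpha> (2 / 3) M \<longrightarrow>
        real n \<ge> c * (real d / (\<alpha> * \<epsilon> * ln (real d))))"
\<comment> \<open>The threshold 1/96 is the one that keeps d g \<le> 1; the constant 3840 is 2 *
  1920, the factor 2 paying for ln d \<ge> 1/2.\<close>
proof (rule exI[of _ "1 / 96"], rule exI[of _ "1 / 3840"], intro conjI allI impI)
  fix \<alpha> \<epsilon> :: real and d n :: nat and M
  assume \<alpha>: "0 < \<alpha>" "\<alpha> < 1 / 96" and \<epsilon>: "0 < \<epsilon>" and d: "2 \<le> d" and n: "1 \<le> n"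
    and M: "mechanism n (bitcube d) (prob_algebra (bitcube d)) M"
      "differentially_private n (bitcube d) (prob_algebra (bitcube d)) \<epsilon> (3 / (64 * real n)) M"
      "estimates_product_distributions n d \<alpha> (2 / 3) M"
  have bound: "real d \<le> 1920 * (real n * \<alpha> * \<epsilon>)"
    using \<alpha> \<epsilon> d n M by (intro private_estimation_bound[where M=M]) auto
  have "1 / 2 \<le> ln (2 :: real)" using ln2_ge_two_thirds by simp
  also have "\<dots> \<le> ln (real d)" using d by simp
  finally have ln: "1 / 2 \<le> ln (real d)" .
  have "real n * \<alpha> * \<epsilon> * (1 / 2) \<le> real n * \<alpha> * \<epsilon> * ln (real d)"
    using \<alpha> \<epsilon> ln by (intro mult_left_mono) auto
  with bound have "real d \<le> 3840 * (real n * \<alpha> * \<epsilon> * ln (real d))" by linarith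
  moreover have "0 < \<alpha> * \<epsilon> * ln (real d)" using \<alpha> \<epsilon> ln by (intro mult_pos_pos) auto
  ultimately show "1 / 3840 * (real d / (\<alpha> * \<epsilon> * ln (real d))) \<le> real n"
    by (simp add: pos_divide_le_eq mult_ac)
qed auto

end
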